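(* Let $\mathcal C$ be a class of group homomorphisms and let $(F,\eta)$ be a $\mathcal C$-lifting functor such that $F(p)$ is an epimorphism for every $p\in\mathcal C$. Let $\mathcal D$ be a class of group homomorphisms such that $(\overline F,\overline\eta)$ is a $\mathcal D$-lifting functor and $F(a)$ is an epimorphism for every $a\in\mathcal D$. Then $(\mathscr F,\widehat\eta)$ is a $\widehat{\mathcal D,\mathcal C}$-lifting functor on the arrow category $\operatorname{Arr}(\mathbf{Grp})$.
   Context: Let $\mathbf{Grp}$ be the category of groups, $F\colon\mathbf{Grp}\to\mathbf{Grp}$ an endofunctor and $\eta\colon F\Rightarrow\mathrm{Id}_{\mathbf{Grp}}$ a natural transformation. For a class $\mathcal C$ of group homomorphisms, $(F,\eta)$ is a $\mathcal C$-lifting functor if for every $p\colon\widetilde G\to G$ in $\mathcal C$ there is a homomorphism $S\colon F(G)\to\widetilde G$ (a lifting along $p$) with $pS=\eta_G$ and $SF(p)=\eta_{\widetilde G}$. Put $H_F(G)=\ker\eta_G$, $\overline F(G)=F(G)/H_F(G)$ with quotient map $q_G\colon F(G)\to\overline F(G)$; $\overline F$ is an endofunctor of $\mathbf{Grp}$, and $\eta$ induces a natural transformation $\overline\eta\colon\overline F\Rightarrow\mathrm{Id}$ whose components $\overline\eta_G\colon\overline F(G)\to G$ are injective, with $\overline\eta_Gq_G=\eta_G$. $\operatorname{Arr}(\mathbf{Grp})$ is the arrow category: objects are homomorphisms $f\colon\Gamma\to G$, and a morphism $(a,b)\colon f_1\to f_2$, where $f_i\colon\Gamma_i\to G_i$,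 is a pair $a\colon\Gamma_1\to\Gamma_2$, $b\colon G_1\to G_2$ with $bf_1=f_2a$. For classes $\mathcal D,\mathcal C$ of homomorphisms, $\widehat{\mathcal D,\mathcal C}$ is the class of morphisms $(a,b)$ with $a\in\mathcal D$, $b\in\mathcal C$. For a class $\mathcal A$ of morphisms of $\operatorname{Arr}(\mathbf{Grp})$, an endofunctor $\mathscr G$ of $\operatorname{Arr}(\mathbf{Grp})$ with a natural transformation $\theta\colon\mathscr G\Rightarrow\mathrm{Id}$ is an $\mathcal A$-lifting functor if for every $u\colon f_1\to f_2$ in $\mathcal A$ there is a morphism $L\colon\mathscr G(f_2)\to f_1$ with $uL=\theta_{f_2}$ and $L\mathscr G(u)=\theta_{f_1}$. For $f\colon\Gamma\to G$ let $N_F(f)$ be the normal closure in $F(G)$ of $F(f)(H_F(\Gamma))$, $F_f(G)=F(G)/N_F(f)$, and $\pi_f\colon F(G)\to F_f(G)$ the quotient map; let $\eta_f\colon F_f(G)\to G$ be determined by $\eta_f\pi_f=\eta_G$, and $\rho_f\colon\overline F(\Gamma)\to F_f(G)$ by $\rho_fq_\Gamma=\pi_fF(f)$. The endofunctor $\mathscr F$ of $\operatorname{Arr}(\mathbf{Grp})$ sends $f$ to the arrow $\rho_f\colon\overline F(\Gamma)\to F_f(G)$ and a morphism $(a,b)\colon f_1\to f_2$ to $(\overline F(a),\beta_{a,b})$, where $\beta_{a,b}\colon F_{f_1}(G_1)\to F_{f_2}(G_2)$ is determined by $\beta_{a,b}\pi_{f_1}=\pi_{f_2}F(b)$. The natural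 transformation $\widehat\eta\colon\mathscr F\Rightarrow\mathrm{Id}$ has components $\widehat\eta_f=(\overline\eta_\Gamma,\eta_f)$. *)

theory Defs
  imports "HOL-Algebra.Coset"
begin

text \<open>
  The type variable of the carriers plays the role of the universe: \<open>Grp\<close> over \<open>'a\<close> has as objects
  all groups \<open>G :: 'a monoid\<close>. Arrows may connect groups over different types. An endofunctor of
  \<open>Grp\<close> with a transformation to \<open>Id\<close> is rendered as a functor from groups over \<open>'a\<close> to
  groups over \<open>'b\<close> with homomorphisms \<open>F G \<rightarrow> G\<close>; the case \<open>'b = 'a\<close> is the literal one. The second
  type is needed because \<open>F(G) Mod N\<close> lives over \<open>'b set\<close>, and it also allows \<open>F(G)\<close> to be
  larger than every group over \<open>'a\<close>. No functor is ever iterated.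
\<close>

subsection \<open>Groups and homomorphisms\<close>

datatype ('a, 'b) ghom =
  GHom (gdom: "'a monoid") (gcod: "'b monoid") (gmap: "'a \<Rightarrow> 'b")

text \<open>Underlying functions are extensional, so that equality of arrows is equality of
  homomorphisms.\<close>

definition is_ghom :: "('a, 'b) ghom \<Rightarrow> bool" where
  "is_ghom f \<longleftrightarrow> group (gdom f) \<and> group (gcod f) \<and>
     gmap f \<in> hom (gdom f) (gcod f) \<inter> extensional (carrier (gdom f))"

definition ghoms :: "'a monoid \<Rightarrow> 'b monoid \<Rightarrow> ('a, 'b) ghom set" where
  "ghoms G H = {f. is_ghom f \<and> gdom f = G \<and> gcod f = H}"

definition gid :: "'a monoid \<Rightarrow> ('a, 'a) ghom" where
  "gid G = GHom G G (\<lambda>x\<in>carrier G. x)"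

definition gcomp :: "('b, 'c) ghom \<Rightarrow> ('a, 'b) ghom \<Rightarrow> ('a, 'c) ghom"
    (infixl \<open>\<circ>\<^sub>G\<close> 55) where
  "g \<circ>\<^sub>G f = GHom (gdom f) (gcod g) (compose (carrier (gdom f)) (gmap g) (gmap f))"

text \<open>Epimorphisms of groups are the surjective homomorphisms.\<close>

definition is_gepi :: "('a, 'b) ghom \<Rightarrow> bool" where
  "is_gepi f \<longleftrightarrow> is_ghom f \<and> gmap f \<in> epi (gdom f) (gcod f)"

subsection \<open>Lifting functors on groups\<close>

record ('o, 'p, 'm, 'n) functor_data =
  on_obj :: "'o \<Rightarrow> 'p"
  on_mor :: "'m \<Rightarrow> 'n"

type_synonym ('a, 'b) grp_functor =
  "('a monoid, 'b monoid, ('a, 'a) ghom, ('b, 'b) ghom) functor_data"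

definition is_grp_functor :: "('a, 'b) grp_functor \<Rightarrow> bool" where
  "is_grp_functor F \<longleftrightarrow>
     (\<forall>G. group G \<longrightarrow> group (on_obj F G)) \<and>
     (\<forall>f. is_ghom f \<longrightarrow> on_mor F f \<in> ghoms (on_obj F (gdom f)) (on_obj F (gcod f))) \<and>
     (\<forall>G. group G \<longrightarrow> on_mor F (gid G) = gid (on_obj F G)) \<and>
     (\<forall>f g. is_ghom f \<longrightarrow> is_ghom g \<longrightarrow> gcod f = gdom g \<longrightarrow>
        on_mor F (g \<circ>\<^sub>G f) = on_mor F g \<circ>\<^sub>G on_mor F f)"

definition is_grp_nat_to_Id ::
    "('a, 'b) grp_functor \<Rightarrow> ('a monoid \<Rightarrow> ('b, 'a) ghom) \<Rightarrow> bool" where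
  "is_grp_nat_to_Id F \<eta> \<longleftrightarrow>
     (\<forall>G. group G \<longrightarrow> \<eta> G \<in> ghoms (on_obj F G) G) \<and>
     (\<forall>f. is_ghom f \<longrightarrow> f \<circ>\<^sub>G \<eta> (gdom f) = \<eta> (gcod f) \<circ>\<^sub>G on_mor F f)"

definition is_grp_lifting_functor ::
    "('a, 'a) ghom set \<Rightarrow> ('a, 'b) grp_functor \<Rightarrow> ('a monoid \<Rightarrow> ('b, 'a) ghom) \<Rightarrow> bool" where
  "is_grp_lifting_functor C F \<eta> \<longleftrightarrow> is_grp_functor F \<and> is_grp_nat_to_Id F \<eta> \<and>
     (\<forall>p\<in>C. \<exists>S\<in>ghoms (on_obj F (gcod p)) (gdom p).
        p \<circ>\<^sub>G S = \<eta> (gcod p) \<and> S \<circ>\<^sub>G on_mor F p = \<eta> (gdom p))"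

subsection \<open>Quotients\<close>

definition quot_hom :: "'b monoid \<Rightarrow> 'b set \<Rightarrow> ('b, 'b set) ghom" where
  "quot_hom G N = GHom G (G Mod N) (\<lambda>x\<in>carrier G. N #>\<^bsub>G\<^esub> x)"

text \<open>The homomorphism \<open>g\<close> determined by \<open>g \<circ>\<^sub>G q = h\<close>.\<close>

definition induced :: "('a, 'b) ghom \<Rightarrow> ('a, 'c) ghom \<Rightarrow> ('b, 'c) ghom" where
  "induced q h = (THE g. g \<in> ghoms (gcod q) (gcod h) \<and> g \<circ>\<^sub>G q = h)"

definition normal_closure :: "'b monoid \<Rightarrow> 'b set \<Rightarrow> 'b set" where
  "normal_closure G A = \<Inter>{N. N \<lhd> G \<and> A \<subseteq> N}"

subsection \<open>The functor \<open>Fbar\<close>\<close>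

context
  fixes F :: "('a, 'b) grp_functor" and \<eta> :: "'a monoid \<Rightarrow> ('b, 'a) ghom"
begin

definition HF :: "'a monoid \<Rightarrow> 'b set" where
  "HF G = kernel (on_obj F G) G (gmap (\<eta> G))"

definition qF :: "'a monoid \<Rightarrow> ('b, 'b set) ghom" where
  "qF G = quot_hom (on_obj F G) (HF G)"

definition Fbar :: "('a, 'b set) grp_functor" where
  "Fbar = \<lparr>on_obj = \<lambda>G. on_obj F G Mod HF G,
           on_mor = \<lambda>f. induced (qF (gdom f)) (qF (gcod f) \<circ>\<^sub>G on_mor F f)\<rparr>"

definition eta_bar :: "'a monoid \<Rightarrow> ('b set, 'a) ghom" where
  "eta_bar G = induced (qF G) (\<eta> G)"

end

subsection \<open>The arrow category and its lifting functors\<close>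

text \<open>Objects are homomorphisms; \<open>Sq f\<^sub>1 f\<^sub>2 a b\<close> is the morphism \<open>(a, b) : f\<^sub>1 \<rightarrow> f\<^sub>2\<close>.\<close>

datatype ('a, 'b) square =
  Sq (sdom: "('a, 'a) ghom") (scod: "('b, 'b) ghom")
     (sfst: "('a, 'b) ghom") (ssnd: "('a, 'b) ghom")

definition is_square :: "('a, 'b) square \<Rightarrow> bool" where
  "is_square u \<longleftrightarrow> is_ghom (sdom u) \<and> is_ghom (scod u) \<and>
     sfst u \<in> ghoms (gdom (sdom u)) (gdom (scod u)) \<and>
     ssnd u \<in> ghoms (gcod (sdom u)) (gcod (scod u)) \<and>
     ssnd u \<circ>\<^sub>G sdom u = scod u \<circ>\<^sub>G sfst u"

definition squares :: "('a, 'a) ghom \<Rightarrow> ('b, 'b) ghom \<Rightarrow> ('a, 'b) square set" where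
  "squares f g = {u. is_square u \<and> sdom u = f \<and> scod u = g}"

definition sid :: "('a, 'a) ghom \<Rightarrow> ('a, 'a) square" where
  "sid f = Sq f f (gid (gdom f)) (gid (gcod f))"

definition scomp :: "('b, 'c) square \<Rightarrow> ('a, 'b) square \<Rightarrow> ('a, 'c) square"
    (infixl \<open>\<circ>\<^sub>S\<close> 55) where
  "v \<circ>\<^sub>S u = Sq (sdom u) (scod v) (sfst v \<circ>\<^sub>G sfst u) (ssnd v \<circ>\<^sub>G ssnd u)"

type_synonym ('a, 'b) arr_functor =
  "(('a, 'a) ghom, ('b, 'b) ghom, ('a, 'a) square, ('b, 'b) square) functor_data"

definition is_arr_functor :: "('a, 'b) arr_functor \<Rightarrow> bool" where
  "is_arr_functor F \<longleftrightarrow>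
     (\<forall>f. is_ghom f \<longrightarrow> is_ghom (on_obj F f)) \<and>
     (\<forall>u. is_square u \<longrightarrow> on_mor F u \<in> squares (on_obj F (sdom u)) (on_obj F (scod u))) \<and>
     (\<forall>f. is_ghom f \<longrightarrow> on_mor F (sid f) = sid (on_obj F f)) \<and>
     (\<forall>u v. is_square u \<longrightarrow> is_square v \<longrightarrow> scod u = sdom v \<longrightarrow>
        on_mor F (v \<circ>\<^sub>S u) = on_mor F v \<circ>\<^sub>S on_mor F u)"

definition is_arr_nat_to_Id ::
    "('a, 'b) arr_functor \<Rightarrow> (('a, 'a) ghom \<Rightarrow> ('b, 'a) square) \<Rightarrow> bool" where
  "is_arr_nat_to_Id F \<theta> \<longleftrightarrow>
     (\<forall>f. is_ghom f \<longrightarrow> \<theta> f \<in> squares (on_obj F f) f) \<and>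
     (\<forall>u. is_square u \<longrightarrow> u \<circ>\<^sub>S \<theta> (sdom u) = \<theta> (scod u) \<circ>\<^sub>S on_mor F u)"

definition is_arr_lifting_functor ::
    "('a, 'a) square set \<Rightarrow> ('a, 'b) arr_functor \<Rightarrow> (('a, 'a) ghom \<Rightarrow> ('b, 'a) square) \<Rightarrow> bool" where
  "is_arr_lifting_functor A F \<theta> \<longleftrightarrow> is_arr_functor F \<and> is_arr_nat_to_Id F \<theta> \<and>
     (\<forall>u\<in>A. \<exists>L\<in>squares (on_obj F (scod u)) (sdom u).
        u \<circ>\<^sub>S L = \<theta> (scod u) \<and> L \<circ>\<^sub>S on_mor F u = \<theta> (sdom u))"

definition hat_class ::
    "('a, 'a) ghom set \<Rightarrow> ('a, 'a) ghom set \<Rightarrow> ('a, 'a) square set" where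
  "hat_class D C = {u. is_square u \<and> sfst u \<in> D \<and> ssnd u \<in> C}"

subsection \<open>The functor induced on the arrow category\<close>

context
  fixes F :: "('a, 'b) grp_functor" and \<eta> :: "'a monoid \<Rightarrow> ('b, 'a) ghom"
begin

definition NF :: "('a, 'a) ghom \<Rightarrow> 'b set" where
  "NF f = normal_closure (on_obj F (gcod f)) (gmap (on_mor F f) ` HF F \<eta> (gdom f))"

definition piF :: "('a, 'a) ghom \<Rightarrow> ('b, 'b set) ghom" where
  "piF f = quot_hom (on_obj F (gcod f)) (NF f)"

definition etaF :: "('a, 'a) ghom \<Rightarrow> ('b set, 'a) ghom" where
  "etaF f = induced (piF f) (\<eta> (gcod f))"

definition rhoF :: "('a, 'a) ghom \<Rightarrow> ('b set, 'b set) ghom" where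
  "rhoF f = induced (qF F \<eta> (gdom f)) (piF f \<circ>\<^sub>G on_mor F f)"

definition betaF :: "('a, 'a) square \<Rightarrow> ('b set, 'b set) ghom" where
  "betaF u = induced (piF (sdom u)) (piF (scod u) \<circ>\<^sub>G on_mor F (ssnd u))"

definition arrF :: "('a, 'b set) arr_functor" where
  "arrF = \<lparr>on_obj = rhoF,
           on_mor = \<lambda>u. Sq (rhoF (sdom u)) (rhoF (scod u))
                           (on_mor (Fbar F \<eta>) (sfst u)) (betaF u)\<rparr>"

definition eta_hat :: "('a, 'a) ghom \<Rightarrow> ('b set, 'a) square" where
  "eta_hat f = Sq (rhoF f) f (eta_bar F \<eta> (gdom f)) (etaF f)"

end

end

theory Submission
  imports Defs "HOL-Algebra.Generated_Groups"
begin

text \<open>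
  Let \<open>(a, b)\<close> be a square from \<open>f\<^sub>1 : \<Gamma>\<^sub>1 \<rightarrow> G\<^sub>1\<close> to \<open>f\<^sub>2 : \<Gamma>\<^sub>2 \<rightarrow> G\<^sub>2\<close> with \<open>a \<in> D\<close> and \<open>b \<in> C\<close>. The
  hypotheses give liftings \<open>T : Fbar \<Gamma>\<^sub>2 \<rightarrow> \<Gamma>\<^sub>1\<close> along \<open>a\<close> and \<open>S : F G\<^sub>2 \<rightarrow> G\<^sub>1\<close> along \<open>b\<close>, and the lifting
  along \<open>(a, b)\<close> is \<open>(T, S')\<close>, where \<open>S'\<close> is the factorization of \<open>S\<close> through the quotient map
  \<open>F G\<^sub>2 \<rightarrow> F G\<^sub>2 / N\<^sub>F f\<^sub>2\<close>. Everything rests on the identity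
  \<open>S \<circ> F f\<^sub>2 = f\<^sub>1 \<circ> T \<circ> q\<close>, with \<open>q : F \<Gamma>\<^sub>2 \<rightarrow> Fbar \<Gamma>\<^sub>2\<close> the quotient map (\<open>liftings_compatible\<close>). Both sides
  agree after composition with \<open>F a\<close>: each becomes \<open>f\<^sub>1 \<circ> \<eta>\<close>, the left one because
  \<open>S \<circ> F f\<^sub>2 \<circ> F a = S \<circ> F b \<circ> F f\<^sub>1 = \<eta> \<circ> F f\<^sub>1\<close>, the right one because
  \<open>T \<circ> q \<circ> F a = T \<circ> Fbar a \<circ> q = \<eta>bar \<circ> q = \<eta>\<close>. Since \<open>F a\<close> is surjective, it can be cancelled.

  The identity does two jobs. The map \<open>q\<close> kills \<open>H\<^sub>F \<Gamma>\<^sub>2\<close>, hence so does \<open>S \<circ> F f\<^sub>2\<close>, and therefore \<open>S\<close>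
  kills the normal closure \<open>N\<^sub>F f\<^sub>2\<close> of \<open>F f\<^sub>2 (H\<^sub>F \<Gamma>\<^sub>2)\<close>; so \<open>S'\<close> exists. And, after cancelling \<open>q\<close>, it
  says that \<open>(T, S')\<close> is a square. In functoriality and naturality on arrows, the domain leg is
  the hypothesis on \<open>Fbar\<close>; the codomain leg is checked by cancelling the quotient map
  \<open>F G \<rightarrow> F G / N\<^sub>F f\<close>, because the leg is determined by its composite with that map.
\<close>

section \<open>Composition and cancellation of group homomorphisms\<close>

lemma ghomsD:
  assumes "f \<in> ghoms G H"
  shows "group G" "group H" "gmap f \<in> hom G H" "gmap f \<in> extensional (carrier G)"
    "gdom f = G" "gcod f = H" "is_ghom f"
  using assms by (auto simp: ghoms_def is_ghom_def)

lemma ghomsI: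
  assumes "group G" "group H" "h \<in> hom G H" "h \<in> extensional (carrier G)"
  shows "GHom G H h \<in> ghoms G H"
  using assms by (auto simp: ghoms_def is_ghom_def)

lemma is_ghom_in_ghoms: "is_ghom f \<Longrightarrow> f \<in> ghoms (gdom f) (gcod f)"
  by (simp add: ghoms_def)

lemma ghoms_closed: "f \<in> ghoms G H \<Longrightarrow> x \<in> carrier G \<Longrightarrow> gmap f x \<in> carrier H"
  using ghomsD(3) by (metis hom_carrier image_subset_iff)

lemma ghoms_group_hom: "f \<in> ghoms G H \<Longrightarrow> group_hom G H (gmap f)"
  using ghomsD by (metis group_hom.intro group_hom_axioms.intro)

lemma gcomp_in: "f \<in> ghoms A B \<Longrightarrow> g \<in> ghoms B C \<Longrightarrow> g \<circ>\<^sub>G f \<in> ghoms A C"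
  unfolding gcomp_def
  by (simp add: ghomsD(5,6))
    (blast intro: ghomsI group.hom_compose compose_extensional dest: ghomsD)

lemma gcomp_apply:
  "f \<in> ghoms A B \<Longrightarrow> x \<in> carrier A \<Longrightarrow> gmap (g \<circ>\<^sub>G f) x = gmap g (gmap f x)"
  by (simp add: gcomp_def compose_def ghomsD(5))

lemma ghoms_eqI:
  assumes "f \<in> ghoms G H" "g \<in> ghoms G H" "\<And>x. x \<in> carrier G \<Longrightarrow> gmap f x = gmap g x"
  shows "f = g"
  using assms extensionalityI[of "gmap f" "carrier G" "gmap g"]
  by (simp add: ghomsD ghom.expand)

lemma gcomp_assoc:
  assumes "f \<in> ghoms A B" "g \<in> ghoms B C"
  shows "h \<circ>\<^sub>G g \<circ>\<^sub>G f = h \<circ>\<^sub>G (g \<circ>\<^sub>G f)"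
  using assms ghoms_closed[OF assms(1)]
  by (auto simp: gcomp_def ghomsD(5,6) compose_def)

lemma gid_in: "group G \<Longrightarrow> gid G \<in> ghoms G G"
  unfolding gid_def
  by (rule ghomsI[OF _ _ group.hom_restrict[of G id]]) (simp_all add: hom_def)

lemma gid_apply: "x \<in> carrier G \<Longrightarrow> gmap (gid G) x = x"
  by (simp add: gid_def)

lemma gid_gcomp:
  assumes f: "f \<in> ghoms G H"
  shows "gid H \<circ>\<^sub>G f = f"
  by (rule ghoms_eqI[OF gcomp_in[OF f gid_in] f])
    (simp_all add: ghomsD(2)[OF f] gcomp_apply[OF f] gid_apply ghoms_closed[OF f])

lemma gcomp_gid:
  assumes f: "f \<in> ghoms G H"
  shows "f \<circ>\<^sub>G gid G = f"
  by (rule ghoms_eqI[OF gcomp_in[OF gid_in f] f])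
    (simp_all add: ghomsD(1)[OF f] gcomp_apply[OF gid_in] gid_apply)

lemma gcomp_cancel_epi:
  assumes q: "q \<in> ghoms A B" "is_gepi q"
    and g: "g \<in> ghoms B C" "g' \<in> ghoms B C" "g \<circ>\<^sub>G q = g' \<circ>\<^sub>G q"
  shows "g = g'"
proof (rule ghoms_eqI[OF g(1,2)])
  fix y assume "y \<in> carrier B"
  then obtain x where x: "x \<in> carrier A" "y = gmap q x"
    using q by (auto simp: is_gepi_def epi_def ghomsD(5,6))
  show "gmap g y = gmap g' y"
    using gcomp_apply[OF q(1) x(1)] g(3) x(2) by metis
qed

section \<open>Quotient maps and normal closures\<close>

lemma quot_hom_in:
  assumes "group G" "N \<lhd> G"
  shows "quot_hom G N \<in> ghoms G (G Mod N)"
proof -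
  have "(\<lambda>x\<in>carrier G. N #>\<^bsub>G\<^esub> x) \<in> hom G (G Mod N)"
    by (rule group.hom_restrict[OF assms(1) normal.r_coset_hom_Mod[OF assms(2)]]) simp
  then show ?thesis
    unfolding quot_hom_def using assms by (intro ghomsI) (auto intro: normal.factorgroup_is_group)
qed

lemma quot_hom_epi: "group G \<Longrightarrow> N \<lhd> G \<Longrightarrow> is_gepi (quot_hom G N)"
  using quot_hom_in[of G N]
  by (simp add: is_gepi_def epi_def ghomsD) (simp add: carrier_FactGroup quot_hom_def)

lemma gcomp_cancel_quot:
  assumes "N \<lhd> G" "g \<in> ghoms (G Mod N) K" "g' \<in> ghoms (G Mod N) K"
    "g \<circ>\<^sub>G quot_hom G N = g' \<circ>\<^sub>G quot_hom G N"
  shows "g = g'"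
proof -
  have "group G"
    using assms(1) by (rule normal.axioms(2))
  from quot_hom_in[OF this assms(1)] quot_hom_epi[OF this assms(1)] assms(2-4) show ?thesis
    by (rule gcomp_cancel_epi)
qed

lemma quot_hom_kernel:
  assumes "group G" "N \<lhd> G" "x \<in> N"
  shows "x \<in> carrier G" "gmap (quot_hom G N) x = \<one>\<^bsub>G Mod N\<^esub>"
proof -
  have N: "subgroup N G"
    using assms(2) by (rule normal_imp_subgroup)
  show x: "x \<in> carrier G"
    using N assms(3) by (rule subgroup.mem_carrier)
  show "gmap (quot_hom G N) x = \<one>\<^bsub>G Mod N\<^esub>"
    using group.coset_join2[OF assms(1) x N assms(3)] x by (simp add: quot_hom_def)
qed

text \<open>
  The definite description in \<^const>\<open>induced\<close> is meaningful for quotient maps: existence is the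
  universal property of the quotient, uniqueness holds because the quotient map is surjective.
\<close>

lemma induced_quot:
  assumes N: "N \<lhd> G" and h: "h \<in> ghoms G K" and ker: "N \<subseteq> kernel G K (gmap h)"
  shows "induced (quot_hom G N) h \<in> ghoms (G Mod N) K"
    and "induced (quot_hom G N) h \<circ>\<^sub>G quot_hom G N = h"
proof -
  have G: "group G"
    using h by (rule ghomsD)
  note q = quot_hom_in[OF G N]
  obtain k where k: "k \<in> hom (G Mod N) K"
    "\<And>x. x \<in> carrier G \<Longrightarrow> k (N #>\<^bsub>G\<^esub> x) = gmap h x"
    using group_hom.FactGroup_universal_kernel[OF ghoms_group_hom[OF h] N ker] by blast
  define g where "g = GHom (G Mod N) K (restrict k (carrier (G Mod N)))"
  have g: "g \<in> ghoms (G Mod N) K"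
    unfolding g_def
    by (intro ghomsI ghomsD(2)[OF q] ghomsD(2)[OF h] group.hom_restrict[OF ghomsD(2)[OF q] k(1)]) simp_all
  have gq: "g \<circ>\<^sub>G quot_hom G N = h"
  proof (rule ghoms_eqI[OF gcomp_in[OF q g] h])
    fix x assume x: "x \<in> carrier G"
    then have "N #>\<^bsub>G\<^esub> x \<in> carrier (G Mod N)"
      by (simp add: carrier_FactGroup)
    then show "gmap (g \<circ>\<^sub>G quot_hom G N) x = gmap h x"
      using k(2)[OF x] x by (simp add: gcomp_apply[OF q x]) (simp add: g_def quot_hom_def)
  qed
  have "\<exists>!g. g \<in> ghoms (gcod (quot_hom G N)) (gcod h) \<and> g \<circ>\<^sub>G quot_hom G N = h"
    unfolding ghomsD(6)[OF q] ghomsD(6)[OF h]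
    using g gq gcomp_cancel_quot[OF N] by metis
  from theI'[OF this]
  show "induced (quot_hom G N) h \<in> ghoms (G Mod N) K"
    and "induced (quot_hom G N) h \<circ>\<^sub>G quot_hom G N = h"
    by (auto simp: induced_def ghomsD(6)[OF q] ghomsD(6)[OF h])
qed

lemma normal_Inter:
  assumes "group G" "\<N> \<noteq> {}" "\<And>N. N \<in> \<N> \<Longrightarrow> N \<lhd> G"
  shows "\<Inter>\<N> \<lhd> G"
proof -
  interpret group G by fact
  show ?thesis
    using assms(2,3) subgroups_Inter[of \<N>] by (auto simp: normal_inv_iff)
qed

lemma normal_closure_normal:
  assumes "group G" "A \<subseteq> carrier G"
  shows "normal_closure G A \<lhd> G"
  unfolding normal_closure_def
  by (rule normal_Inter) (use assms group.normal_self in auto)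

lemma normal_closure_superset: "A \<subseteq> normal_closure G A"
  by (auto simp: normal_closure_def)

text \<open>Because a kernel is normal, it suffices to test a homomorphism on generators.\<close>

lemma normal_closure_subset_kernel:
  assumes "h \<in> ghoms G K" "A \<subseteq> kernel G K (gmap h)"
  shows "normal_closure G A \<subseteq> kernel G K (gmap h)"
  using group_hom.normal_kernel[OF ghoms_group_hom[OF assms(1)]] assms(2)
  by (auto simp: normal_closure_def)

section \<open>The augmented functor on groups and its quotient\<close>

locale augmented_functor =
  fixes F :: "('a, 'b) grp_functor" and \<eta> :: "'a monoid \<Rightarrow> ('b, 'a) ghom"
  assumes F_functor: "is_grp_functor F" and eta_nat: "is_grp_nat_to_Id F \<eta>"
begin

lemma F_group: "group G \<Longrightarrow> group (on_obj F G)"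
  using F_functor by (simp add: is_grp_functor_def)

lemma F_mor: "f \<in> ghoms G H \<Longrightarrow> on_mor F f \<in> ghoms (on_obj F G) (on_obj F H)"
  using F_functor unfolding is_grp_functor_def by (metis ghomsD(5-7))

lemma F_id: "group G \<Longrightarrow> on_mor F (gid G) = gid (on_obj F G)"
  using F_functor by (simp add: is_grp_functor_def)

lemma F_comp:
  "f \<in> ghoms A B \<Longrightarrow> g \<in> ghoms B C \<Longrightarrow> on_mor F (g \<circ>\<^sub>G f) = on_mor F g \<circ>\<^sub>G on_mor F f"
  using F_functor unfolding is_grp_functor_def by (metis ghomsD(5-7))

lemma eta_in: "group G \<Longrightarrow> \<eta> G \<in> ghoms (on_obj F G) G"
  using eta_nat by (simp add: is_grp_nat_to_Id_def)

lemma eta_natural: "f \<in> ghoms G H \<Longrightarrow> f \<circ>\<^sub>G \<eta> G = \<eta> H \<circ>\<^sub>G on_mor F f"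
  using eta_nat unfolding is_grp_nat_to_Id_def by (metis ghomsD(5-7))

lemma HF_normal: "group G \<Longrightarrow> HF F \<eta> G \<lhd> on_obj F G"
  unfolding HF_def by (rule group_hom.normal_kernel[OF ghoms_group_hom[OF eta_in]])

lemma F_mor_HF:
  assumes f: "f \<in> ghoms G H" and x: "x \<in> HF F \<eta> G"
  shows "gmap (on_mor F f) x \<in> HF F \<eta> H"
proof -
  have G: "group G" and H: "group H"
    using f by (auto dest: ghomsD)
  have xc: "x \<in> carrier (on_obj F G)" and x1: "gmap (\<eta> G) x = \<one>\<^bsub>G\<^esub>"
    using x by (auto simp: HF_def kernel_def)
  have "gmap (\<eta> H) (gmap (on_mor F f) x) = gmap f (gmap (\<eta> G) x)"
    using gcomp_apply[OF eta_in[OF G] xc, of f] gcomp_apply[OF F_mor[OF f] xc, of "\<eta> H"]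
    by (simp add: eta_natural[OF f])
  also have "\<dots> = \<one>\<^bsub>H\<^esub>"
    unfolding x1 by (rule group_hom.hom_one[OF ghoms_group_hom[OF f]])
  finally show ?thesis
    using ghoms_closed[OF F_mor[OF f] xc] by (simp add: HF_def kernel_def)
qed

lemma Fbar_obj [simp]: "on_obj (Fbar F \<eta>) G = on_obj F G Mod HF F \<eta> G"
  by (simp add: Fbar_def)

lemma qF_in: "group G \<Longrightarrow> qF F \<eta> G \<in> ghoms (on_obj F G) (on_obj (Fbar F \<eta>) G)"
  by (simp add: qF_def quot_hom_in F_group HF_normal)

lemma qF_cancel:
  assumes "group G" "g \<in> ghoms (on_obj (Fbar F \<eta>) G) K" "g' \<in> ghoms (on_obj (Fbar F \<eta>) G) K"
    "g \<circ>\<^sub>G qF F \<eta> G = g' \<circ>\<^sub>G qF F \<eta> G"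
  shows "g = g'"
  using assms gcomp_cancel_quot[OF HF_normal] by (simp add: qF_def)

lemma qF_HF:
  assumes "group G" "x \<in> HF F \<eta> G"
  shows "x \<in> carrier (on_obj F G)" "gmap (qF F \<eta> G) x = \<one>\<^bsub>on_obj (Fbar F \<eta>) G\<^esub>"
  using quot_hom_kernel[OF F_group HF_normal] assms by (auto simp: qF_def)

lemma eta_bar_in: "group G \<Longrightarrow> eta_bar F \<eta> G \<in> ghoms (on_obj (Fbar F \<eta>) G) G"
  and eta_bar_qF: "group G \<Longrightarrow> eta_bar F \<eta> G \<circ>\<^sub>G qF F \<eta> G = \<eta> G"
  using induced_quot[OF HF_normal eta_in, of G]
  by (auto simp: eta_bar_def qF_def HF_def)

lemma Fbar_mor:
  assumes f: "f \<in> ghoms G H"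
  shows "on_mor (Fbar F \<eta>) f \<in> ghoms (on_obj (Fbar F \<eta>) G) (on_obj (Fbar F \<eta>) H)"
    and "on_mor (Fbar F \<eta>) f \<circ>\<^sub>G qF F \<eta> G = qF F \<eta> H \<circ>\<^sub>G on_mor F f"
proof -
  have G: "group G" and H: "group H"
    using f by (auto dest: ghomsD)
  have h: "qF F \<eta> H \<circ>\<^sub>G on_mor F f \<in> ghoms (on_obj F G) (on_obj (Fbar F \<eta>) H)"
    by (rule gcomp_in[OF F_mor[OF f] qF_in[OF H]])
  have "HF F \<eta> G \<subseteq> kernel (on_obj F G) (on_obj (Fbar F \<eta>) H) (gmap (qF F \<eta> H \<circ>\<^sub>G on_mor F f))"
    using qF_HF(1)[OF G] qF_HF(2)[OF H F_mor_HF[OF f]]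
    by (auto simp: kernel_def gcomp_apply[OF F_mor[OF f]])
  from induced_quot[OF HF_normal[OF G] h this]
  show "on_mor (Fbar F \<eta>) f \<in> ghoms (on_obj (Fbar F \<eta>) G) (on_obj (Fbar F \<eta>) H)"
    and "on_mor (Fbar F \<eta>) f \<circ>\<^sub>G qF F \<eta> G = qF F \<eta> H \<circ>\<^sub>G on_mor F f"
    by (simp_all add: Fbar_def qF_def ghomsD(5,6)[OF f])
qed

section \<open>The quotient of the codomain attached to an arrow\<close>

lemma NF_generators:
  assumes f: "f \<in> ghoms \<Gamma> G"
  shows "gmap (on_mor F f) ` HF F \<eta> \<Gamma> \<subseteq> carrier (on_obj F G)"
  using ghoms_closed[OF F_mor[OF f]] qF_HF(1)[OF ghomsD(1)[OF f]] by blast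

lemma NF_normal: "f \<in> ghoms \<Gamma> G \<Longrightarrow> NF F \<eta> f \<lhd> on_obj F G"
  using normal_closure_normal[OF F_group NF_generators]
  by (simp add: NF_def ghomsD)

text \<open>
  A homomorphism on \<open>F G\<close> that, pulled back along \<open>F f\<close>, factors through \<open>Fbar \<Gamma>\<close> is trivial on the
  normal closure of \<open>F f (H\<^sub>F \<Gamma>)\<close>. All homomorphisms out of \<open>F\<^sub>f G\<close> below arise in this way.
\<close>

lemma NF_subset_kernel:
  assumes f: "f \<in> ghoms \<Gamma> G" and h: "h \<in> ghoms (on_obj F G) K"
    and k: "k \<in> ghoms (on_obj (Fbar F \<eta>) \<Gamma>) K" and eq: "h \<circ>\<^sub>G on_mor F f = k \<circ>\<^sub>G qF F \<eta> \<Gamma>"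
  shows "NF F \<eta> f \<subseteq> kernel (on_obj F G) K (gmap h)"
proof -
  have \<Gamma>: "group \<Gamma>"
    using f by (rule ghomsD)
  have "gmap h (gmap (on_mor F f) x) = \<one>\<^bsub>K\<^esub>" if x: "x \<in> HF F \<eta> \<Gamma>" for x
  proof -
    note xc = qF_HF(1)[OF \<Gamma> x]
    have "gmap h (gmap (on_mor F f) x) = gmap k (gmap (qF F \<eta> \<Gamma>) x)"
      using gcomp_apply[OF F_mor[OF f] xc, of h] gcomp_apply[OF qF_in[OF \<Gamma>] xc, of k] eq by simp
    then show ?thesis
      using group_hom.hom_one[OF ghoms_group_hom[OF k]] qF_HF(2)[OF \<Gamma> x] by simp
  qed
  then have "gmap (on_mor F f) ` HF F \<eta> \<Gamma> \<subseteq> kernel (on_obj F G) K (gmap h)"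
    using NF_generators[OF f] by (auto simp: kernel_def)
  from normal_closure_subset_kernel[OF h this] show ?thesis
    by (simp add: NF_def ghomsD(5,6)[OF f])
qed

lemma piF_in: "f \<in> ghoms \<Gamma> G \<Longrightarrow> piF F \<eta> f \<in> ghoms (on_obj F G) (on_obj F G Mod NF F \<eta> f)"
  using quot_hom_in[OF F_group NF_normal] by (simp add: piF_def ghomsD)

lemma piF_cancel:
  assumes "f \<in> ghoms \<Gamma> G" "g \<in> ghoms (on_obj F G Mod NF F \<eta> f) K"
    "g' \<in> ghoms (on_obj F G Mod NF F \<eta> f) K" "g \<circ>\<^sub>G piF F \<eta> f = g' \<circ>\<^sub>G piF F \<eta> f"
  shows "g = g'"
  using gcomp_cancel_quot[OF NF_normal[OF assms(1)] assms(2,3)] assms(1,4)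
  by (simp add: piF_def ghomsD)

lemma piF_factor:
  assumes f: "f \<in> ghoms \<Gamma> G" and h: "h \<in> ghoms (on_obj F G) K"
    and k: "k \<in> ghoms (on_obj (Fbar F \<eta>) \<Gamma>) K" "h \<circ>\<^sub>G on_mor F f = k \<circ>\<^sub>G qF F \<eta> \<Gamma>"
  shows "induced (piF F \<eta> f) h \<in> ghoms (on_obj F G Mod NF F \<eta> f) K"
    and "induced (piF F \<eta> f) h \<circ>\<^sub>G piF F \<eta> f = h"
  using induced_quot[OF NF_normal[OF f] h NF_subset_kernel[OF f h k]]
  by (simp_all add: piF_def ghomsD[OF f])

lemma etaF:
  assumes f: "f \<in> ghoms \<Gamma> G"
  shows "etaF F \<eta> f \<in> ghoms (on_obj F G Mod NF F \<eta> f) G"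
    and "etaF F \<eta> f \<circ>\<^sub>G piF F \<eta> f = \<eta> G"
proof -
  have \<Gamma>: "group \<Gamma>" and G: "group G"
    using f by (auto dest: ghomsD)
  have "\<eta> G \<circ>\<^sub>G on_mor F f = f \<circ>\<^sub>G eta_bar F \<eta> \<Gamma> \<circ>\<^sub>G qF F \<eta> \<Gamma>"
    by (simp only: gcomp_assoc[OF qF_in[OF \<Gamma>] eta_bar_in[OF \<Gamma>]] eta_bar_qF[OF \<Gamma>] eta_natural[OF f])
  from piF_factor[OF f eta_in[OF G] gcomp_in[OF eta_bar_in[OF \<Gamma>] f] this]
  show "etaF F \<eta> f \<in> ghoms (on_obj F G Mod NF F \<eta> f) G"
    and "etaF F \<eta> f \<circ>\<^sub>G piF F \<eta> f = \<eta> G"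
    by (simp_all add: etaF_def ghomsD[OF f])
qed

lemma rhoF:
  assumes f: "f \<in> ghoms \<Gamma> G"
  shows "rhoF F \<eta> f \<in> ghoms (on_obj (Fbar F \<eta>) \<Gamma>) (on_obj F G Mod NF F \<eta> f)"
    and "rhoF F \<eta> f \<circ>\<^sub>G qF F \<eta> \<Gamma> = piF F \<eta> f \<circ>\<^sub>G on_mor F f"
proof -
  have \<Gamma>: "group \<Gamma>" and G: "group G"
    using f by (auto dest: ghomsD)
  let ?h = "piF F \<eta> f \<circ>\<^sub>G on_mor F f"
  have h: "?h \<in> ghoms (on_obj F \<Gamma>) (on_obj F G Mod NF F \<eta> f)"
    by (rule gcomp_in[OF F_mor[OF f] piF_in[OF f]])
  have "HF F \<eta> \<Gamma> \<subseteq> kernel (on_obj F \<Gamma>) (on_obj F G Mod NF F \<eta> f) (gmap ?h)"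
  proof
    fix x assume x: "x \<in> HF F \<eta> \<Gamma>"
    have "gmap (on_mor F f) x \<in> NF F \<eta> f"
      using x normal_closure_superset by (fastforce simp: NF_def ghomsD(5,6)[OF f])
    then show "x \<in> kernel (on_obj F \<Gamma>) (on_obj F G Mod NF F \<eta> f) (gmap ?h)"
      using quot_hom_kernel(2)[OF F_group[OF G] NF_normal[OF f]] qF_HF(1)[OF \<Gamma> x]
      by (simp add: kernel_def gcomp_apply[OF F_mor[OF f]]) (simp add: piF_def ghomsD(6)[OF f])
  qed
  from induced_quot[OF HF_normal[OF \<Gamma>] h this]
  show "rhoF F \<eta> f \<in> ghoms (on_obj (Fbar F \<eta>) \<Gamma>) (on_obj F G Mod NF F \<eta> f)"
    and "rhoF F \<eta> f \<circ>\<^sub>G qF F \<eta> \<Gamma> = piF F \<eta> f \<circ>\<^sub>G on_mor F f"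
    by (simp_all add: rhoF_def qF_def ghomsD(5)[OF f])
qed

end

section \<open>The induced functor on arrows\<close>

lemma squaresD:
  assumes "is_square u"
  shows "sdom u \<in> ghoms (gdom (sdom u)) (gcod (sdom u))"
    "scod u \<in> ghoms (gdom (scod u)) (gcod (scod u))"
    "sfst u \<in> ghoms (gdom (sdom u)) (gdom (scod u))"
    "ssnd u \<in> ghoms (gcod (sdom u)) (gcod (scod u))"
    "ssnd u \<circ>\<^sub>G sdom u = scod u \<circ>\<^sub>G sfst u"
  using assms by (auto simp: is_square_def is_ghom_in_ghoms)

lemma squaresI:
  assumes "f \<in> ghoms A B" "g \<in> ghoms A' B'" "a \<in> ghoms A A'" "b \<in> ghoms B B'"
    "b \<circ>\<^sub>G f = g \<circ>\<^sub>G a"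
  shows "Sq f g a b \<in> squares f g"
  using assms by (simp add: squares_def is_square_def ghomsD)

context augmented_functor
begin

lemma F_square:
  assumes u: "is_square u"
  shows "on_mor F (ssnd u) \<circ>\<^sub>G on_mor F (sdom u) = on_mor F (scod u) \<circ>\<^sub>G on_mor F (sfst u)"
  using squaresD[OF u] by (simp flip: F_comp)

text \<open>
  The condition of \<open>piF_factor\<close> holds with \<open>k = \<rho>\<^sub>f\<^sub>2 \<circ> Fbar a\<close>, and the witness reappears as the
  commutativity of the square \<open>(Fbar a, \<beta>)\<close>.
\<close>

lemma betaF:
  assumes u: "is_square u"
  shows "betaF F \<eta> u \<in> ghoms (on_obj F (gcod (sdom u)) Mod NF F \<eta> (sdom u))
           (on_obj F (gcod (scod u)) Mod NF F \<eta> (scod u))"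
    and "betaF F \<eta> u \<circ>\<^sub>G piF F \<eta> (sdom u) = piF F \<eta> (scod u) \<circ>\<^sub>G on_mor F (ssnd u)"
    and "betaF F \<eta> u \<circ>\<^sub>G rhoF F \<eta> (sdom u) = rhoF F \<eta> (scod u) \<circ>\<^sub>G on_mor (Fbar F \<eta>) (sfst u)"
proof -
  note f1 = squaresD(1)[OF u] and f2 = squaresD(2)[OF u] and a = squaresD(3)[OF u]
    and b = squaresD(4)[OF u]
  note \<Gamma>1 = ghomsD(1)[OF f1] and \<Gamma>2 = ghomsD(1)[OF f2]
  let ?f1 = "sdom u" and ?f2 = "scod u" and ?a = "sfst u" and ?b = "ssnd u"
  let ?k = "rhoF F \<eta> ?f2 \<circ>\<^sub>G on_mor (Fbar F \<eta>) ?a"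
  have h: "piF F \<eta> ?f2 \<circ>\<^sub>G on_mor F ?b \<in> ghoms (on_obj F (gcod ?f1)) (on_obj F (gcod ?f2) Mod NF F \<eta> ?f2)"
    by (rule gcomp_in[OF F_mor[OF b] piF_in[OF f2]])
  have k: "?k \<in> ghoms (on_obj (Fbar F \<eta>) (gdom ?f1)) (on_obj F (gcod ?f2) Mod NF F \<eta> ?f2)"
    by (rule gcomp_in[OF Fbar_mor(1)[OF a] rhoF(1)[OF f2]])
  have eq: "piF F \<eta> ?f2 \<circ>\<^sub>G on_mor F ?b \<circ>\<^sub>G on_mor F ?f1 = ?k \<circ>\<^sub>G qF F \<eta> (gdom ?f1)"
  proof -
    have "piF F \<eta> ?f2 \<circ>\<^sub>G on_mor F ?b \<circ>\<^sub>G on_mor F ?f1 = piF F \<eta> ?f2 \<circ>\<^sub>G on_mor F ?f2 \<circ>\<^sub>G on_mor F ?a"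
      by (simp only: gcomp_assoc[OF F_mor[OF f1] F_mor[OF b]] F_square[OF u]
          gcomp_assoc[OF F_mor[OF a] F_mor[OF f2]])
    also have "\<dots> = rhoF F \<eta> ?f2 \<circ>\<^sub>G (qF F \<eta> (gdom ?f2) \<circ>\<^sub>G on_mor F ?a)"
      by (simp only: rhoF(2)[OF f2, symmetric] gcomp_assoc[OF F_mor[OF a] qF_in[OF \<Gamma>2]])
    also have "\<dots> = ?k \<circ>\<^sub>G qF F \<eta> (gdom ?f1)"
      by (simp only: Fbar_mor(2)[OF a, symmetric] gcomp_assoc[OF qF_in[OF \<Gamma>1] Fbar_mor(1)[OF a]])
    finally show ?thesis .
  qed
  show \<beta>: "betaF F \<eta> u \<in> ghoms (on_obj F (gcod ?f1) Mod NF F \<eta> ?f1)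
           (on_obj F (gcod ?f2) Mod NF F \<eta> ?f2)"
    and \<beta>\<pi>: "betaF F \<eta> u \<circ>\<^sub>G piF F \<eta> ?f1 = piF F \<eta> ?f2 \<circ>\<^sub>G on_mor F ?b"
    unfolding betaF_def by (rule piF_factor[OF f1 h k eq])+
  show "betaF F \<eta> u \<circ>\<^sub>G rhoF F \<eta> ?f1 = ?k"
  proof (rule qF_cancel[OF \<Gamma>1 gcomp_in[OF rhoF(1)[OF f1] \<beta>] k])
    show "betaF F \<eta> u \<circ>\<^sub>G rhoF F \<eta> ?f1 \<circ>\<^sub>G qF F \<eta> (gdom ?f1) = ?k \<circ>\<^sub>G qF F \<eta> (gdom ?f1)"
      by (simp only: gcomp_assoc[OF qF_in[OF \<Gamma>1] rhoF(1)[OF f1]] rhoF(2)[OF f1]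
          gcomp_assoc[OF F_mor[OF f1] piF_in[OF f1], symmetric] \<beta>\<pi> eq)
  qed
qed

lemma betaF_id:
  assumes f: "f \<in> ghoms \<Gamma> G"
  shows "betaF F \<eta> (sid f) = gid (on_obj F G Mod NF F \<eta> f)"
proof -
  have \<Gamma>: "group \<Gamma>" and G: "group G"
    using f by (auto dest: ghomsD)
  have sq: "is_square (sid f)"
    using f \<Gamma> G by (simp add: is_square_def sid_def ghomsD[OF f] gid_in gid_gcomp gcomp_gid)
  have [simp]: "sdom (sid f) = f" "scod (sid f) = f" "ssnd (sid f) = gid G" "gcod f = G"
    by (simp_all add: sid_def ghomsD[OF f])
  note \<beta> = betaF[OF sq, simplified]
  show ?thesis
    by (rule piF_cancel[OF f \<beta>(1)])
      (simp_all add: \<beta>(2) F_id[OF G] gcomp_gid[OF piF_in[OF f]] gid_gcomp[OF piF_in[OF f]]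
        gid_in[OF ghomsD(2)[OF piF_in[OF f]]])
qed

lemma scomp_square:
  assumes u: "is_square u" and v: "is_square v" and uv: "scod u = sdom v"
  shows "is_square (v \<circ>\<^sub>S u)"
proof -
  note u' = squaresD[OF u, unfolded uv] and v' = squaresD[OF v]
  have "ssnd v \<circ>\<^sub>G ssnd u \<circ>\<^sub>G sdom u = scod v \<circ>\<^sub>G (sfst v \<circ>\<^sub>G sfst u)"
    by (simp only: gcomp_assoc[OF u'(1) u'(4)] u'(5) gcomp_assoc[OF u'(3) v'(1), symmetric] v'(5)
        gcomp_assoc[OF u'(3) v'(3)])
  then show ?thesis
    using u v gcomp_in[OF u'(3) v'(3)] gcomp_in[OF u'(4) v'(4)]
    by (simp add: is_square_def scomp_def)
qed

lemma betaF_comp: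
  assumes u: "is_square u" and v: "is_square v" and uv: "scod u = sdom v"
  shows "betaF F \<eta> (v \<circ>\<^sub>S u) = betaF F \<eta> v \<circ>\<^sub>G betaF F \<eta> u"
proof -
  note u' = squaresD[OF u, unfolded uv] and v' = squaresD[OF v]
  note \<beta>u = betaF[OF u, unfolded uv] and \<beta>v = betaF[OF v]
  have [simp]: "sdom (v \<circ>\<^sub>S u) = sdom u" "scod (v \<circ>\<^sub>S u) = scod v"
    "ssnd (v \<circ>\<^sub>S u) = ssnd v \<circ>\<^sub>G ssnd u"
    by (simp_all add: scomp_def)
  note \<beta>vu = betaF[OF scomp_square[OF u v uv], simplified]
  have "betaF F \<eta> v \<circ>\<^sub>G betaF F \<eta> u \<circ>\<^sub>G piF F \<eta> (sdom u)
      = betaF F \<eta> v \<circ>\<^sub>G piF F \<eta> (sdom v) \<circ>\<^sub>G on_mor F (ssnd u)"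
    by (simp only: gcomp_assoc[OF piF_in[OF u'(1)] \<beta>u(1)] \<beta>u(2)
        gcomp_assoc[OF F_mor[OF u'(4)] piF_in[OF v'(1)]])
  also have "\<dots> = piF F \<eta> (scod v) \<circ>\<^sub>G on_mor F (ssnd v \<circ>\<^sub>G ssnd u)"
    by (simp only: \<beta>v(2) gcomp_assoc[OF F_mor[OF u'(4)] F_mor[OF v'(4)]] F_comp[OF u'(4) v'(4)])
  finally show ?thesis
    using piF_cancel[OF u'(1) \<beta>vu(1) gcomp_in[OF \<beta>u(1) \<beta>v(1)]] \<beta>vu(2) by simp
qed

lemma arrF_functor:
  assumes Fbar: "is_grp_functor (Fbar F \<eta>)"
  shows "is_arr_functor (arrF F \<eta>)"
  unfolding is_arr_functor_def
proof (intro conjI allI impI)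
  fix f :: "('a, 'a) ghom" assume "is_ghom f"
  then have f: "f \<in> ghoms (gdom f) (gcod f)"
    by (rule is_ghom_in_ghoms)
  show "is_ghom (on_obj (arrF F \<eta>) f)"
    using rhoF(1)[OF f] by (simp add: arrF_def ghomsD)
  have "on_mor (Fbar F \<eta>) (gid (gdom f)) = gid (on_obj (Fbar F \<eta>) (gdom f))"
    using Fbar ghomsD(1)[OF f] unfolding is_grp_functor_def by blast
  then show "on_mor (arrF F \<eta>) (sid f) = sid (on_obj (arrF F \<eta>) f)"
    using betaF_id[OF f] rhoF(1)[OF f] by (simp add: arrF_def sid_def ghomsD)
next
  fix u :: "('a, 'a) square" assume u: "is_square u"
  show "on_mor (arrF F \<eta>) u \<in> squares (on_obj (arrF F \<eta>) (sdom u)) (on_obj (arrF F \<eta>) (scod u))"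
    using squaresI[OF rhoF(1)[OF squaresD(1)[OF u]] rhoF(1)[OF squaresD(2)[OF u]]
        Fbar_mor(1)[OF squaresD(3)[OF u]] betaF(1)[OF u] betaF(3)[OF u]]
    by (simp add: arrF_def)
next
  fix u v :: "('a, 'a) square"
  assume u: "is_square u" and v: "is_square v" and uv: "scod u = sdom v"
  have "on_mor (Fbar F \<eta>) (sfst v \<circ>\<^sub>G sfst u) = on_mor (Fbar F \<eta>) (sfst v) \<circ>\<^sub>G on_mor (Fbar F \<eta>) (sfst u)"
    using Fbar squaresD(3)[OF u, unfolded uv] squaresD(3)[OF v]
    unfolding is_grp_functor_def by (metis ghomsD(5-7))
  then show "on_mor (arrF F \<eta>) (v \<circ>\<^sub>S u) = on_mor (arrF F \<eta>) v \<circ>\<^sub>S on_mor (arrF F \<eta>) u"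
    using betaF_comp[OF u v uv] by (simp add: arrF_def scomp_def)
qed

lemma eta_hat_natural:
  assumes Fbar: "is_grp_nat_to_Id (Fbar F \<eta>) (eta_bar F \<eta>)"
  shows "is_arr_nat_to_Id (arrF F \<eta>) (eta_hat F \<eta>)"
  unfolding is_arr_nat_to_Id_def
proof (intro conjI allI impI)
  fix f :: "('a, 'a) ghom" assume "is_ghom f"
  then have f: "f \<in> ghoms (gdom f) (gcod f)"
    by (rule is_ghom_in_ghoms)
  note \<Gamma> = ghomsD(1)[OF f]
  have "etaF F \<eta> f \<circ>\<^sub>G rhoF F \<eta> f = f \<circ>\<^sub>G eta_bar F \<eta> (gdom f)"
  proof (rule qF_cancel[OF \<Gamma> gcomp_in[OF rhoF(1)[OF f] etaF(1)[OF f]] gcomp_in[OF eta_bar_in[OF \<Gamma>] f]])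
    show "etaF F \<eta> f \<circ>\<^sub>G rhoF F \<eta> f \<circ>\<^sub>G qF F \<eta> (gdom f)
        = f \<circ>\<^sub>G eta_bar F \<eta> (gdom f) \<circ>\<^sub>G qF F \<eta> (gdom f)"
      by (simp only: gcomp_assoc[OF qF_in[OF \<Gamma>] rhoF(1)[OF f]] rhoF(2)[OF f]
          gcomp_assoc[OF F_mor[OF f] piF_in[OF f], symmetric] etaF(2)[OF f]
          gcomp_assoc[OF qF_in[OF \<Gamma>] eta_bar_in[OF \<Gamma>]] eta_bar_qF[OF \<Gamma>] eta_natural[OF f])
  qed
  from squaresI[OF rhoF(1)[OF f] f eta_bar_in[OF \<Gamma>] etaF(1)[OF f] this]
  show "eta_hat F \<eta> f \<in> squares (on_obj (arrF F \<eta>) f) f"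
    by (simp add: eta_hat_def arrF_def)
next
  fix u :: "('a, 'a) square" assume u: "is_square u"
  note f1 = squaresD(1)[OF u] and f2 = squaresD(2)[OF u] and a = squaresD(3)[OF u]
    and b = squaresD(4)[OF u]
  have fst: "sfst u \<circ>\<^sub>G eta_bar F \<eta> (gdom (sdom u))
      = eta_bar F \<eta> (gdom (scod u)) \<circ>\<^sub>G on_mor (Fbar F \<eta>) (sfst u)"
    using Fbar a unfolding is_grp_nat_to_Id_def by (metis ghomsD(5-7))
  have snd: "ssnd u \<circ>\<^sub>G etaF F \<eta> (sdom u) = etaF F \<eta> (scod u) \<circ>\<^sub>G betaF F \<eta> u"
  proof (rule piF_cancel[OF f1 gcomp_in[OF etaF(1)[OF f1] b] gcomp_in[OF betaF(1)[OF u] etaF(1)[OF f2]]])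
    show "ssnd u \<circ>\<^sub>G etaF F \<eta> (sdom u) \<circ>\<^sub>G piF F \<eta> (sdom u)
        = etaF F \<eta> (scod u) \<circ>\<^sub>G betaF F \<eta> u \<circ>\<^sub>G piF F \<eta> (sdom u)"
      by (simp only: gcomp_assoc[OF piF_in[OF f1] etaF(1)[OF f1]] etaF(2)[OF f1] eta_natural[OF b]
          gcomp_assoc[OF piF_in[OF f1] betaF(1)[OF u]] betaF(2)[OF u]
          gcomp_assoc[OF F_mor[OF b] piF_in[OF f2], symmetric] etaF(2)[OF f2])
  qed
  show "u \<circ>\<^sub>S eta_hat F \<eta> (sdom u) = eta_hat F \<eta> (scod u) \<circ>\<^sub>S on_mor (arrF F \<eta>) u"
    using fst snd by (simp add: scomp_def eta_hat_def arrF_def)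
qed

section \<open>Lifting along squares\<close>

text \<open>
  The liftings along the two legs of a square are chosen independently of each other; surjectivity
  of \<open>F a\<close> is what makes them compatible.
\<close>

lemma liftings_compatible:
  assumes u: "is_square u" and epi: "is_gepi (on_mor F (sfst u))"
    and S: "S \<in> ghoms (on_obj F (gcod (scod u))) (gcod (sdom u))"
      "S \<circ>\<^sub>G on_mor F (ssnd u) = \<eta> (gcod (sdom u))"
    and T: "T \<in> ghoms (on_obj (Fbar F \<eta>) (gdom (scod u))) (gdom (sdom u))"
      "T \<circ>\<^sub>G on_mor (Fbar F \<eta>) (sfst u) = eta_bar F \<eta> (gdom (sdom u))"
  shows "S \<circ>\<^sub>G on_mor F (scod u) = sdom u \<circ>\<^sub>G T \<circ>\<^sub>G qF F \<eta> (gdom (scod u))"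
proof -
  note f1 = squaresD(1)[OF u] and f2 = squaresD(2)[OF u] and a = squaresD(3)[OF u]
    and b = squaresD(4)[OF u]
  note \<Gamma>1 = ghomsD(1)[OF f1] and \<Gamma>2 = ghomsD(1)[OF f2]
  note f1T = gcomp_in[OF T(1) f1]
  show ?thesis
  proof (rule gcomp_cancel_epi[OF F_mor[OF a] epi gcomp_in[OF F_mor[OF f2] S(1)]
        gcomp_in[OF qF_in[OF \<Gamma>2] f1T]])
    have "S \<circ>\<^sub>G on_mor F (scod u) \<circ>\<^sub>G on_mor F (sfst u) = S \<circ>\<^sub>G on_mor F (ssnd u) \<circ>\<^sub>G on_mor F (sdom u)"
      by (simp only: gcomp_assoc[OF F_mor[OF a] F_mor[OF f2]] F_square[OF u, symmetric]
          gcomp_assoc[OF F_mor[OF f1] F_mor[OF b]])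
    also have "\<dots> = sdom u \<circ>\<^sub>G (eta_bar F \<eta> (gdom (sdom u)) \<circ>\<^sub>G qF F \<eta> (gdom (sdom u)))"
      by (simp only: S(2) eta_natural[OF f1] eta_bar_qF[OF \<Gamma>1])
    also have "\<dots> = sdom u \<circ>\<^sub>G (T \<circ>\<^sub>G (qF F \<eta> (gdom (scod u)) \<circ>\<^sub>G on_mor F (sfst u)))"
      by (simp only: T(2)[symmetric] gcomp_assoc[OF qF_in[OF \<Gamma>1] Fbar_mor(1)[OF a]] Fbar_mor(2)[OF a])
    also have "\<dots> = sdom u \<circ>\<^sub>G T \<circ>\<^sub>G qF F \<eta> (gdom (scod u)) \<circ>\<^sub>G on_mor F (sfst u)"
      by (simp only: gcomp_assoc[OF F_mor[OF a] qF_in[OF \<Gamma>2]]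
          gcomp_assoc[OF gcomp_in[OF F_mor[OF a] qF_in[OF \<Gamma>2]] T(1)])
    finally show "S \<circ>\<^sub>G on_mor F (scod u) \<circ>\<^sub>G on_mor F (sfst u)
        = sdom u \<circ>\<^sub>G T \<circ>\<^sub>G qF F \<eta> (gdom (scod u)) \<circ>\<^sub>G on_mor F (sfst u)" .
  qed
qed

lemma square_lifting:
  assumes u: "is_square u" and epi: "is_gepi (on_mor F (sfst u))"
    and S: "S \<in> ghoms (on_obj F (gcod (scod u))) (gcod (sdom u))"
      "ssnd u \<circ>\<^sub>G S = \<eta> (gcod (scod u))" "S \<circ>\<^sub>G on_mor F (ssnd u) = \<eta> (gcod (sdom u))"
    and T: "T \<in> ghoms (on_obj (Fbar F \<eta>) (gdom (scod u))) (gdom (sdom u))"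
      "sfst u \<circ>\<^sub>G T = eta_bar F \<eta> (gdom (scod u))"
      "T \<circ>\<^sub>G on_mor (Fbar F \<eta>) (sfst u) = eta_bar F \<eta> (gdom (sdom u))"
  shows "\<exists>L\<in>squares (on_obj (arrF F \<eta>) (scod u)) (sdom u).
    u \<circ>\<^sub>S L = eta_hat F \<eta> (scod u) \<and> L \<circ>\<^sub>S on_mor (arrF F \<eta>) u = eta_hat F \<eta> (sdom u)"
proof -
  note f1 = squaresD(1)[OF u] and f2 = squaresD(2)[OF u] and b = squaresD(4)[OF u]
  note \<Gamma>2 = ghomsD(1)[OF f2]
  note f1T = gcomp_in[OF T(1) f1] and compat = liftings_compatible[OF u epi S(1,3) T(1,3)]
  define S' where "S' = induced (piF F \<eta> (scod u)) S"
  have S': "S' \<in> ghoms (on_obj F (gcod (scod u)) Mod NF F \<eta> (scod u)) (gcod (sdom u))"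
    and S'\<pi>: "S' \<circ>\<^sub>G piF F \<eta> (scod u) = S"
    unfolding S'_def by (rule piF_factor[OF f2 S(1) f1T compat])+
  have sq: "S' \<circ>\<^sub>G rhoF F \<eta> (scod u) = sdom u \<circ>\<^sub>G T"
  proof (rule qF_cancel[OF \<Gamma>2 gcomp_in[OF rhoF(1)[OF f2] S'] f1T])
    show "S' \<circ>\<^sub>G rhoF F \<eta> (scod u) \<circ>\<^sub>G qF F \<eta> (gdom (scod u))
        = sdom u \<circ>\<^sub>G T \<circ>\<^sub>G qF F \<eta> (gdom (scod u))"
      by (simp only: gcomp_assoc[OF qF_in[OF \<Gamma>2] rhoF(1)[OF f2]] rhoF(2)[OF f2]
          gcomp_assoc[OF F_mor[OF f2] piF_in[OF f2], symmetric] S'\<pi> compat)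
  qed
  have lift: "ssnd u \<circ>\<^sub>G S' = etaF F \<eta> (scod u)"
    by (rule piF_cancel[OF f2 gcomp_in[OF S' b] etaF(1)[OF f2]])
      (simp only: gcomp_assoc[OF piF_in[OF f2] S'] S'\<pi> S(2) etaF(2)[OF f2])
  have lift': "S' \<circ>\<^sub>G betaF F \<eta> u = etaF F \<eta> (sdom u)"
    by (rule piF_cancel[OF f1 gcomp_in[OF betaF(1)[OF u] S'] etaF(1)[OF f1]])
      (simp only: gcomp_assoc[OF piF_in[OF f1] betaF(1)[OF u]] betaF(2)[OF u]
        gcomp_assoc[OF F_mor[OF b] piF_in[OF f2], symmetric] S'\<pi> S(3) etaF(2)[OF f1])
  show ?thesis
  proof (intro bexI conjI)
    let ?L = "Sq (rhoF F \<eta> (scod u)) (sdom u) T S'"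
    show "?L \<in> squares (on_obj (arrF F \<eta>) (scod u)) (sdom u)"
      using squaresI[OF rhoF(1)[OF f2] f1 T(1) S' sq] by (simp add: arrF_def)
    show "u \<circ>\<^sub>S ?L = eta_hat F \<eta> (scod u)"
      using T(2) lift by (simp add: scomp_def eta_hat_def)
    show "?L \<circ>\<^sub>S on_mor (arrF F \<eta>) u = eta_hat F \<eta> (sdom u)"
      using T(3) lift' by (simp add: scomp_def eta_hat_def arrF_def)
  qed
qed

end

theorem theorem3p2:
  fixes F :: "('a, 'b) grp_functor"
    and \<eta> :: "'a monoid \<Rightarrow> ('b, 'a) ghom"
    and C D :: "('a, 'a) ghom set"
  assumes "C \<subseteq> {p. is_ghom p}"
    and "is_grp_lifting_functor C F \<eta>"
    and "\<forall>p\<in>C. is_gepi (on_mor F p)"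
    and "D \<subseteq> {a. is_ghom a}"
    and "is_grp_lifting_functor D (Fbar F \<eta>) (eta_bar F \<eta>)"
    and "\<forall>a\<in>D. is_gepi (on_mor F a)"
  shows "is_arr_lifting_functor (hat_class D C) (arrF F \<eta>) (eta_hat F \<eta>)"
proof -
  interpret augmented_functor F \<eta>
    using assms(2) unfolding is_grp_lifting_functor_def by unfold_locales blast+
  have "\<exists>L\<in>squares (on_obj (arrF F \<eta>) (scod u)) (sdom u).
      u \<circ>\<^sub>S L = eta_hat F \<eta> (scod u) \<and> L \<circ>\<^sub>S on_mor (arrF F \<eta>) u = eta_hat F \<eta> (sdom u)"
    if "u \<in> hat_class D C" for u
  proof -
    have u: "is_square u" and a: "sfst u \<in> D" and b: "ssnd u \<in> C"
      using that by (auto simp: hat_class_def)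
    obtain S where S: "S \<in> ghoms (on_obj F (gcod (ssnd u))) (gdom (ssnd u))"
      "ssnd u \<circ>\<^sub>G S = \<eta> (gcod (ssnd u))" "S \<circ>\<^sub>G on_mor F (ssnd u) = \<eta> (gdom (ssnd u))"
      using assms(2) b unfolding is_grp_lifting_functor_def by blast
    obtain T where T: "T \<in> ghoms (on_obj (Fbar F \<eta>) (gcod (sfst u))) (gdom (sfst u))"
      "sfst u \<circ>\<^sub>G T = eta_bar F \<eta> (gcod (sfst u))"
      "T \<circ>\<^sub>G on_mor (Fbar F \<eta>) (sfst u) = eta_bar F \<eta> (gdom (sfst u))"
      using assms(5) a unfolding is_grp_lifting_functor_def by blast
    note ends = ghomsD(5,6)[OF squaresD(3)[OF u]] ghomsD(5,6)[OF squaresD(4)[OF u]]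
    show ?thesis
      using square_lifting[OF u _ S[unfolded ends] T[unfolded ends]] assms(6) a by blast
  qed
  then show ?thesis
    using arrF_functor eta_hat_natural assms(5)
    unfolding is_arr_lifting_functor_def is_grp_lifting_functor_def by blast
qed

end
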